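(* Let $Y$ be a geodesic manifold and let $C\subset Y$ be a closed connected locally convex subset. Then $C$ is weakly convex.
   Context: **Convexity space.** For a Hausdorff space $U$, the power set $\mathfrak P(U)$ carries the topology with basis the sets $\widetilde W=\{A\subset U : A\subset W\}$, $W$ open in $U$. A convexity space is a Hausdorff space $U$ with a continuous map $C\colon U\times U\to\mathfrak P(U)$ such that, calling $A\subset U$ convex if $C(x,y)\subset A$ for all $x,y\in A$: (C1) every $C(x,y)$ is convex; (C2) every $C(x,y)$ is minimal among the connected sets containing $x$ and $y$; (C3) $U$ has a basis of convex open sets. A convex subset of a convexity space is a convexity space with the restricted map. **Local convexity structure.** A local convexity structure (atlas) on a topological space $Y$ is an open covering $\mathfrak V$ of $Y$ by convexity spaces $V\in\mathfrak V$ (with the induced topology) such that every convex open subspace of each $V\in\mathfrak V$ belongs to $\mathfrak V$ (as a convexity space). $A\subset Y$ is convex if $A\cap V$ is convex in $V$ for all $V\in\mathfrak V$; $A$ is locally convex if every $z\in A$ has a neighbourhood $V\in\mathfrak V$ such that $A\cap V$ is convex. The convex hull $C(A)$ of $A\subset Y$ is the smallest convex set containing $A$. **Étale maps.** For a continuous map $e\colon C\to Y$ with $C$ a connected topological space, $\mathfrak V_e$ is the set of all open $U\subset C$ which are mapped by $e$ homeomorphically onto a convex subspace of some $V\in\mathfrak V$. $e$ is étale if $e$ is a closed map and $\mathfrak V_e$ covers $C$. $e$ is generated by $F\subset C$ if there is no closed connected subspace $A\subsetneq C$ with $F\subset A$ such that $e(U\cap A)$ is convex (in the chart $V$ in which $e(U)$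 is a convex subspace) for all $U\in\mathfrak V_e$. **Geodesic manifold.** A geodesic manifold is a Hausdorff space $Y$ with a local convexity structure $\mathfrak V$ such that: (G1) for every finite $F\subset Y$, the closure of $C(F)$ is compact; (G2) if an étale map $e\colon C\to Y$ with $C$ compact is generated by $\{x,y\}\subset C$, then every connected set $A\subset C$ with $x,y\in A$ equals $C$. **Geodesics, weak convexity.** A geodesic in $Y$ is an étale map $e\colon C\to Y$ with $C$ compact, generated by some $\{x,y\}\subset C$; $e(x),e(y)$ are its end points. A subset $A\subset Y$ is weakly convex if for all $a,b\in A$ there is a geodesic in $Y$ with end points $a,b$ whose image is contained in $A$. *)

theory Defs
  imports "HOL-Analysis.Analysis"
begin

section \<open>Convexity spaces\<close>

definition power_topology :: "'a topology \<Rightarrow> 'a set topology" where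
  "power_topology U = topology_generated_by {Pow W | W. openin U W}"

definition convex_wrt :: "('a \<times> 'a \<Rightarrow> 'a set) \<Rightarrow> 'a set \<Rightarrow> bool" where
  "convex_wrt c A \<longleftrightarrow> (\<forall>x\<in>A. \<forall>y\<in>A. c (x, y) \<subseteq> A)"

definition convexity_space :: "'a topology \<Rightarrow> ('a \<times> 'a \<Rightarrow> 'a set) \<Rightarrow> bool" where
  "convexity_space U c \<longleftrightarrow>
     Hausdorff_space U \<and>
     continuous_map (prod_topology U U) (power_topology U) c \<and>
     (\<forall>x\<in>topspace U. \<forall>y\<in>topspace U. convex_wrt c (c (x, y))) \<and>
     (\<forall>x\<in>topspace U. \<forall>y\<in>topspace U.
        connectedin U (c (x, y)) \<and> x \<in> c (x, y) \<and> y \<in> c (x, y) \<and>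
        (\<forall>B. connectedin U B \<and> x \<in> B \<and> y \<in> B \<and> B \<subseteq> c (x, y) \<longrightarrow> B = c (x, y))) \<and>
     openin U = arbitrary union_of (\<lambda>B. openin U B \<and> convex_wrt c B)"

section \<open>Local convexity structures\<close>

text \<open>
  A chart is a set together with its convexity map; only the values of the map on pairs of points
  of the set are meaningful.
\<close>

type_synonym 'a chart = "'a set \<times> ('a \<times> 'a \<Rightarrow> 'a set)"

definition local_convexity_structure :: "'a topology \<Rightarrow> 'a chart set \<Rightarrow> bool" where
  "local_convexity_structure Y \<V> \<longleftrightarrow>
     \<Union>(fst ` \<V>) = topspace Y \<and>
     (\<forall>(V, c)\<in>\<V>. openin Y V \<and> convexity_space (subtopology Y V) c \<and>
        (\<forall>W. openin (subtopology Y V) W \<and> convex_wrt c W \<longrightarrow>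
           (\<exists>c'. (W, c') \<in> \<V> \<and> (\<forall>p\<in>W \<times> W. c' p = c p))))"

definition convex_in :: "'a topology \<Rightarrow> 'a chart set \<Rightarrow> 'a set \<Rightarrow> bool" where
  "convex_in Y \<V> A \<longleftrightarrow> A \<subseteq> topspace Y \<and> (\<forall>(V, c)\<in>\<V>. convex_wrt c (A \<inter> V))"

definition locally_convex_in :: "'a topology \<Rightarrow> 'a chart set \<Rightarrow> 'a set \<Rightarrow> bool" where
  "locally_convex_in Y \<V> A \<longleftrightarrow>
     A \<subseteq> topspace Y \<and> (\<forall>z\<in>A. \<exists>(V, c)\<in>\<V>. z \<in> V \<and> convex_wrt c (A \<inter> V))"

section \<open>Etale maps\<close>

definition etale_chart ::
    "'a topology \<Rightarrow> 'c topology \<Rightarrow> ('c \<Rightarrow> 'a) \<Rightarrow> 'c set \<Rightarrow> 'a chart \<Rightarrow> bool" where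
  "etale_chart Y X e U = (\<lambda>(V, c).
     openin X U \<and> e ` U \<subseteq> V \<and> convex_wrt c (e ` U) \<and>
     homeomorphic_map (subtopology X U) (subtopology Y (e ` U)) e)"

definition etale_cover ::
    "'a topology \<Rightarrow> 'a chart set \<Rightarrow> 'c topology \<Rightarrow> ('c \<Rightarrow> 'a) \<Rightarrow> 'c set set" where
  "etale_cover Y \<V> X e = {U. \<exists>v\<in>\<V>. etale_chart Y X e U v}"

definition etale_map ::
    "'a topology \<Rightarrow> 'a chart set \<Rightarrow> 'c topology \<Rightarrow> ('c \<Rightarrow> 'a) \<Rightarrow> bool" where
  "etale_map Y \<V> X e \<longleftrightarrow>
     connected_space X \<and> continuous_map X Y e \<and> closed_map X Y e \<and>
     \<Union>(etale_cover Y \<V> X e) = topspace X"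

definition generated_by ::
    "'a topology \<Rightarrow> 'a chart set \<Rightarrow> 'c topology \<Rightarrow> ('c \<Rightarrow> 'a) \<Rightarrow> 'c set \<Rightarrow> bool" where
  "generated_by Y \<V> X e F \<longleftrightarrow>
     F \<subseteq> topspace X \<and>
     \<not> (\<exists>A. closedin X A \<and> connectedin X A \<and> A \<subset> topspace X \<and> F \<subseteq> A \<and>
            (\<forall>U. \<forall>(V, c)\<in>\<V>. etale_chart Y X e U (V, c) \<longrightarrow> convex_wrt c (e ` (U \<inter> A))))"

section \<open>Geodesic manifolds\<close>

text \<open>
  Compact domains are understood to be Hausdorff. This is essential for the second axiom of a
  geodesic manifold: the non-Hausdorff interval with a doubled interior point is quasi-compact, its
  projection to the real line is etale and generated by the two end points, but removing one copy
  of the doubled point leaves a connected proper subset.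
\<close>

definition geodesic ::
    "'a topology \<Rightarrow> 'a chart set \<Rightarrow> 'c topology \<Rightarrow> ('c \<Rightarrow> 'a) \<Rightarrow> 'c \<Rightarrow> 'c \<Rightarrow> bool" where
  "geodesic Y \<V> X e x y \<longleftrightarrow>
     compact_space X \<and> Hausdorff_space X \<and> etale_map Y \<V> X e \<and> generated_by Y \<V> X e {x, y}"

text \<open>
  The quantifiers over all compact spaces below range over topologies with points in
  \<^typ>\<open>'a \<times> nat\<close>. This is no restriction: a compact domain of an etale map is a
  finite union of sets on which the map is injective, so it has a homeomorphic copy of this type.
  See \<open>geodesic_transfer\<close>, \<open>geodesic_manifold_connectedD\<close> and
  \<open>weakly_convex_inI\<close> for the corresponding facts about domains of arbitrary type.
\<close>

definition geodesic_manifold :: "'a topology \<Rightarrow> 'a chart set \<Rightarrow> bool" where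
  "geodesic_manifold Y \<V> \<longleftrightarrow>
     Hausdorff_space Y \<and> local_convexity_structure Y \<V> \<and>
     (\<forall>F. finite F \<and> F \<subseteq> topspace Y \<longrightarrow> compactin Y (Y closure_of (convex_in Y \<V> hull F))) \<and>
     (\<forall>(X :: ('a \<times> nat) topology) e x y. geodesic Y \<V> X e x y \<longrightarrow>
        (\<forall>A. connectedin X A \<and> x \<in> A \<and> y \<in> A \<longrightarrow> A = topspace X))"

definition weakly_convex_in :: "'a topology \<Rightarrow> 'a chart set \<Rightarrow> 'a set \<Rightarrow> bool" where
  "weakly_convex_in Y \<V> A \<longleftrightarrow>
     A \<subseteq> topspace Y \<and>
     (\<forall>a\<in>A. \<forall>b\<in>A. \<exists>(X :: ('a \<times> nat) topology) e x y.
        geodesic Y \<V> X e x y \<and> e x = a \<and> e y = b \<and> e ` topspace X \<subseteq> A)"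

section \<open>Independence of the type of the domain\<close>

lemma etale_chart_transfer:
  assumes h: "homeomorphic_maps X X' f g" and U: "etale_chart Y X e U v"
  shows "etale_chart Y X' (e \<circ> g) (f ` U) v"
proof -
  obtain V c where v: "v = (V, c)" by (cases v)
  have U': "openin X U" "e ` U \<subseteq> V" "convex_wrt c (e ` U)"
    and hU: "homeomorphic_map (subtopology X U) (subtopology Y (e ` U)) e"
    using U by (auto simp: v etale_chart_def)
  have sub: "U \<subseteq> topspace X" using U'(1) by (rule openin_subset)
  have gf: "g (f p) = p" if "p \<in> U" for p
    using h sub that by (auto simp: homeomorphic_maps_def)
  have im: "(e \<circ> g) ` (f ` U) = e ` U"
    using gf by (force simp: image_iff)
  have hf: "homeomorphic_map X X' f" and hg: "homeomorphic_map X' X g"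
    using h by (auto simp: homeomorphic_maps_map)
  have "openin X' (f ` U)"
    using hf U'(1) sub homeomorphic_map_openness by blast
  moreover have "homeomorphic_map (subtopology X' (f ` U)) (subtopology X U) g"
  proof (rule homeomorphic_map_subtopologies[OF hg])
    have "f ` U \<subseteq> topspace X'"
      using hf sub homeomorphic_imp_surjective_map by blast
    moreover have "g ` f ` U = U" using gf by force
    ultimately show "g ` (topspace X' \<inter> f ` U) = topspace X \<inter> U"
      using sub by (simp add: Int_absorb1)
  qed
  then have "homeomorphic_map (subtopology X' (f ` U)) (subtopology Y (e ` U)) (e \<circ> g)"
    using hU homeomorphic_map_compose by blast
  ultimately show ?thesis
    using U' unfolding v etale_chart_def im by simp
qed

lemma geodesic_homeomorphic:
  assumes h: "homeomorphic_maps X X' f g" and geo: "geodesic Y \<V> X e x y"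
  shows "geodesic Y \<V> X' (e \<circ> g) (f x) (f y)"
proof -
  have hf: "homeomorphic_map X X' f" and hg: "homeomorphic_map X' X g"
    using h by (auto simp: homeomorphic_maps_map)
  have h': "homeomorphic_maps X' X g f"
    using h homeomorphic_maps_sym by blast
  have hs: "X homeomorphic_space X'"
    using h by (auto simp: homeomorphic_space_def)
  have gf: "g (f p) = p" if "p \<in> topspace X" for p
    using h that by (auto simp: homeomorphic_maps_def)
  have fg: "f (g p) = p" if "p \<in> topspace X'" for p
    using h that by (auto simp: homeomorphic_maps_def)
  have fX: "f ` topspace X = topspace X'" and gX: "g ` topspace X' = topspace X"
    using hf hg homeomorphic_imp_surjective_map by blast+
  have et: "etale_map Y \<V> X e" and gen: "generated_by Y \<V> X e {x, y}"
    and xy: "x \<in> topspace X" "y \<in> topspace X"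
    using geo by (auto simp: geodesic_def generated_by_def)
  have "compact_space X'" "Hausdorff_space X'"
    using geo hs homeomorphic_compact_space homeomorphic_Hausdorff_space
    unfolding geodesic_def by blast+
  moreover have "etale_map Y \<V> X' (e \<circ> g)"
    unfolding etale_map_def
  proof (intro conjI)
    show "connected_space X'"
      using et hs homeomorphic_connected_space unfolding etale_map_def by blast
    show "continuous_map X' Y (e \<circ> g)"
      using et hg continuous_map_compose homeomorphic_imp_continuous_map
      unfolding etale_map_def by blast
    show "closed_map X' Y (e \<circ> g)"
      using et hg closed_map_compose homeomorphic_imp_closed_map
      unfolding etale_map_def by blast
    show "\<Union>(etale_cover Y \<V> X' (e \<circ> g)) = topspace X'"
    proof
      show "\<Union>(etale_cover Y \<V> X' (e \<circ> g)) \<subseteq> topspace X'"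
        by (auto simp: etale_cover_def etale_chart_def dest: openin_subset)
      show "topspace X' \<subseteq> \<Union>(etale_cover Y \<V> X' (e \<circ> g))"
      proof
        fix p assume p: "p \<in> topspace X'"
        then have "g p \<in> topspace X" using gX by blast
        then obtain U v where U: "g p \<in> U" "v \<in> \<V>" "etale_chart Y X e U v"
          using et unfolding etale_map_def etale_cover_def by blast
        have "f ` U \<in> etale_cover Y \<V> X' (e \<circ> g)"
          using U(2) etale_chart_transfer[OF h U(3)] unfolding etale_cover_def by blast
        moreover have "p \<in> f ` U"
          using U(1) fg[OF p] by (rule rev_image_eqI[OF _ sym])
        ultimately show "p \<in> \<Union>(etale_cover Y \<V> X' (e \<circ> g))" by blast
      qed
    qed
  qed
  moreover have "generated_by Y \<V> X' (e \<circ> g) {f x, f y}"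
    unfolding generated_by_def
  proof (intro conjI notI)
    show "{f x, f y} \<subseteq> topspace X'" using xy fX by blast
    assume "\<exists>A. closedin X' A \<and> connectedin X' A \<and> A \<subset> topspace X' \<and> {f x, f y} \<subseteq> A \<and>
      (\<forall>U. \<forall>(V, c)\<in>\<V>. etale_chart Y X' (e \<circ> g) U (V, c) \<longrightarrow> convex_wrt c ((e \<circ> g) ` (U \<inter> A)))"
    then obtain A where A: "closedin X' A" "connectedin X' A" "A \<subset> topspace X'" "{f x, f y} \<subseteq> A"
      and cv0: "\<forall>U. \<forall>(V, c)\<in>\<V>. etale_chart Y X' (e \<circ> g) U (V, c)
              \<longrightarrow> convex_wrt c ((e \<circ> g) ` (U \<inter> A))"
      by (elim exE conjE)
    have cv: "convex_wrt c ((e \<circ> g) ` (U \<inter> A))"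
      if "(V, c) \<in> \<V>" "etale_chart Y X' (e \<circ> g) U (V, c)" for U V c
      using bspec[OF spec[OF cv0, of U] that(1)] that(2) by simp
    have "closedin X (g ` A)"
      using A hg homeomorphic_map_closedness_eq by blast
    moreover have "connectedin X (g ` A)"
      using A hg homeomorphic_map_connectedness_eq by blast
    moreover have "g ` A \<subset> topspace X"
    proof -
      obtain p where p: "p \<in> topspace X'" "p \<notin> A" using A by blast
      have "g p \<noteq> g a" if "a \<in> A" for a
      proof
        assume "g p = g a"
        then have "f (g p) = f (g a)" by simp
        then show False using fg p A(3) that by auto
      qed
      then have "g p \<notin> g ` A" by blast
      then show ?thesis using p gX A(3) by blast
    qed
    moreover have "{x, y} \<subseteq> g ` A"
      using A(4) gf[OF xy(1)] gf[OF xy(2)] image_eqI[of x g "f x" A] image_eqI[of y g "f y" A]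
      by simp
    moreover have "\<forall>U. \<forall>(V, c)\<in>\<V>. etale_chart Y X e U (V, c)
        \<longrightarrow> convex_wrt c (e ` (U \<inter> g ` A))"
    proof -
      have "convex_wrt c (e ` (U \<inter> g ` A))"
        if "(V, c) \<in> \<V>" "etale_chart Y X e U (V, c)" for U V c
      proof -
        have sub: "U \<subseteq> topspace X"
          using that(2) by (auto simp: etale_chart_def dest: openin_subset)
        have "g ` (f ` U \<inter> A) = U \<inter> g ` A"
        proof
          show "g ` (f ` U \<inter> A) \<subseteq> U \<inter> g ` A" using gf sub by auto
          show "U \<inter> g ` A \<subseteq> g ` (f ` U \<inter> A)"
          proof
            fix p assume "p \<in> U \<inter> g ` A"
            then obtain a where a: "a \<in> A" "p = g a" "g a \<in> U" by blast
            then have "a = f (g a)" using fg A(3) by auto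
            then show "p \<in> g ` (f ` U \<inter> A)" using a by blast
          qed
        qed
        then have "(e \<circ> g) ` (f ` U \<inter> A) = e ` (U \<inter> g ` A)"
          unfolding image_comp[symmetric] by simp
        then show ?thesis
          using cv[OF that(1) etale_chart_transfer[OF h that(2)]] by simp
      qed
      then show ?thesis by auto
    qed
    ultimately have "\<exists>A. closedin X A \<and> connectedin X A \<and> A \<subset> topspace X \<and> {x, y} \<subseteq> A \<and>
        (\<forall>U. \<forall>(V, c)\<in>\<V>. etale_chart Y X e U (V, c) \<longrightarrow> convex_wrt c (e ` (U \<inter> A)))"
      by (intro exI[of _ "g ` A"] conjI)
    then show False
      using gen unfolding generated_by_def by (elim conjE notE)
  qed
  ultimately show ?thesis by (simp add: geodesic_def)
qed

lemma geodesic_transfer: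
  fixes Y :: "'a topology" and X :: "'c topology"
  assumes geo: "geodesic Y \<V> X e x y"
  obtains X' :: "('a \<times> nat) topology" and f g
  where "homeomorphic_maps X X' f g" "geodesic Y \<V> X' (e \<circ> g) (f x) (f y)"
proof -
  have "\<exists>\<F>. finite \<F> \<and> \<F> \<subseteq> etale_cover Y \<V> X e \<and> topspace X \<subseteq> \<Union>\<F>"
  proof -
    have "compact_space X" "\<Union>(etale_cover Y \<V> X e) = topspace X"
      using geo by (auto simp: geodesic_def etale_map_def)
    moreover have "\<forall>U\<in>etale_cover Y \<V> X e. openin X U"
      by (auto simp: etale_cover_def etale_chart_def)
    ultimately show ?thesis unfolding compact_space_alt by (metis order_refl)
  qed
  then obtain \<F> where F: "finite \<F>" "\<F> \<subseteq> etale_cover Y \<V> X e" "topspace X \<subseteq> \<Union>\<F>"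
    by blast
  have inj: "inj_on e U" if "U \<in> \<F>" for U
  proof -
    have *: "openin X U" "homeomorphic_map (subtopology X U) (subtopology Y (e ` U)) e"
      using that F(2) by (auto simp: etale_cover_def etale_chart_def)
    then have "inj_on e (topspace (subtopology X U))"
      using homeomorphic_imp_injective_map by blast
    then show ?thesis using openin_subset[OF *(1)] by (simp add: Int_absorb1)
  qed
  obtain n :: "'c set \<Rightarrow> nat" where n: "inj_on n \<F>"
    using finite_imp_inj_to_nat_seg[OF F(1)] by blast
  have "\<forall>p\<in>topspace X. \<exists>U. U \<in> \<F> \<and> p \<in> U"
    using F(3) by blast
  then obtain k where k: "\<And>p. p \<in> topspace X \<Longrightarrow> k p \<in> \<F> \<and> p \<in> k p"
    by (auto dest!: bchoice)
  define f where "f = (\<lambda>p. (e p, n (k p)))"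
  have injf: "inj_on f (topspace X)"
  proof (rule inj_onI)
    fix p q assume pq: "p \<in> topspace X" "q \<in> topspace X" "f p = f q"
    then have "k p = k q" using n k by (auto simp: f_def inj_on_def)
    then show "p = q" using pq inj[of "k p"] k[of p] k[of q] by (auto simp: f_def dest: inj_onD)
  qed
  define g where "g = inv_into (topspace X) f"
  have gf: "g (f p) = p" if "p \<in> topspace X" for p
    using injf that by (simp add: g_def)
  define X' where "X' = pullback_topology (f ` topspace X) g X"
  have topX': "topspace X' = f ` topspace X"
    using gf by (auto simp: X'_def topspace_pullback_topology)
  have "homeomorphic_maps X X' f g"
    unfolding homeomorphic_maps_def
  proof (intro conjI ballI)
    show "continuous_map X' X g"
      unfolding X'_def
      using continuous_map_pullback[OF continuous_map_id, of "f ` topspace X" g] by simp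
    show "continuous_map X X' f"
      unfolding X'_def
    proof (rule continuous_map_pullback')
      show "continuous_map X X (g \<circ> f)"
        by (rule continuous_map_eq[OF continuous_map_id]) (simp add: gf)
      show "topspace X \<subseteq> f -` (f ` topspace X)" by blast
    qed
  qed (use gf topX' in auto)
  then show thesis
    by (rule that) (rule geodesic_homeomorphic[OF \<open>homeomorphic_maps X X' f g\<close> geo])
qed

lemma geodesic_manifold_connectedD:
  fixes Y :: "'a topology" and X :: "'c topology"
  assumes "geodesic_manifold Y \<V>" "geodesic Y \<V> X e x y"
    and "connectedin X A" "x \<in> A" "y \<in> A"
  shows "A = topspace X"
  using assms(2)
proof (rule geodesic_transfer)
  fix X' :: "('a \<times> nat) topology" and f g
  assume h: "homeomorphic_maps X X' f g" and geo: "geodesic Y \<V> X' (e \<circ> g) (f x) (f y)"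
  have hf: "homeomorphic_map X X' f" using h by (auto simp: homeomorphic_maps_map)
  have sub: "A \<subseteq> topspace X" using assms(3) connectedin_subset_topspace by blast
  have "connectedin X' (f ` A)"
    using assms(3) hf homeomorphic_map_connectedness_eq by blast
  moreover have "\<forall>(X :: ('a \<times> nat) topology) e x y. geodesic Y \<V> X e x y \<longrightarrow>
      (\<forall>A. connectedin X A \<and> x \<in> A \<and> y \<in> A \<longrightarrow> A = topspace X)"
    using assms(1) unfolding geodesic_manifold_def by (elim conjE)
  note this[rule_format, OF geo, of "f ` A"]
  ultimately have "f ` A = topspace X'"
    using assms(4,5) by simp
  also have "\<dots> = f ` topspace X"
    using hf homeomorphic_imp_surjective_map by blast
  finally show ?thesis
    using homeomorphic_imp_injective_map[OF hf] sub
      inj_on_image_eq_iff[of f "topspace X" A "topspace X"] by simp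
qed

lemma weakly_convex_inI:
  fixes Y :: "'a topology"
  assumes "A \<subseteq> topspace Y"
    and "\<And>a b. a \<in> A \<Longrightarrow> b \<in> A \<Longrightarrow> \<exists>(X :: 'c topology) e x y.
           geodesic Y \<V> X e x y \<and> e x = a \<and> e y = b \<and> e ` topspace X \<subseteq> A"
  shows "weakly_convex_in Y \<V> A"
  unfolding weakly_convex_in_def
proof (intro conjI ballI assms(1))
  fix a b assume "a \<in> A" "b \<in> A"
  from assms(2)[OF this] obtain X :: "'c topology" and e x y
    where geo: "geodesic Y \<V> X e x y" and ab: "e x = a" "e y = b" "e ` topspace X \<subseteq> A"
    by (elim exE conjE)
  obtain X' :: "('a \<times> nat) topology" and f g
    where h: "homeomorphic_maps X X' f g" and geo': "geodesic Y \<V> X' (e \<circ> g) (f x) (f y)"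
    using geo by (rule geodesic_transfer)
  have "x \<in> topspace X" "y \<in> topspace X"
    using geo by (auto simp: geodesic_def generated_by_def)
  then have "g (f x) = x" "g (f y) = y"
    using h by (auto simp: homeomorphic_maps_def)
  moreover have "g ` topspace X' = topspace X"
    by (rule homeomorphic_imp_surjective_map) (use h in \<open>simp add: homeomorphic_maps_map\<close>)
  then have "(e \<circ> g) ` topspace X' \<subseteq> A" using ab(3) unfolding image_comp[symmetric] by simp
  ultimately have "geodesic Y \<V> X' (e \<circ> g) (f x) (f y) \<and> (e \<circ> g) (f x) = a \<and>
      (e \<circ> g) (f y) = b \<and> (e \<circ> g) ` topspace X' \<subseteq> A"
    using geo' ab by simp
  then show "\<exists>(X :: ('a \<times> nat) topology) e x y.
      geodesic Y \<V> X e x y \<and> e x = a \<and> e y = b \<and> e ` topspace X \<subseteq> A" by blast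
qed

end

theory Submission
  imports Defs
begin

text \<open>
  Join two points \<open>a\<close>, \<open>b\<close> of \<open>C\<close> by a finite chain of segments inside \<open>C\<close>. Its vertices form a
  finite set \<open>F\<close>, and the closure \<open>K\<close> of the convex hull of \<open>F\<close> is compact. A segment \<open>c (x, y)\<close> of a
  convexity space is compact, because a finite chain of small connected open pieces leading from \<open>x\<close>
  to \<open>y\<close> already exhausts it, by minimality. This makes closures of convex sets convex, so the
  component of \<open>a\<close> in \<open>C \<inter> K\<close> is a compact connected set containing \<open>a\<close> and \<open>b\<close> which meets
  every convex piece of \<open>C\<close> in a convex set. By Zorn's lemma there is a minimal set with these
  properties, and its inclusion into \<open>Y\<close> is the required geodesic.
\<close>

section \<open>Topological preliminaries\<close>

text \<open>Induction along a connected space: by \<open>loc\<close> the class of \<open>s\<close>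
  is open, and by symmetry and transitivity so is its complement. It serves to build finite chains
  without naming them, with \<open>R\<close> expressing that two points can be joined.\<close>

lemma connected_space_equivalence:
  assumes X: "connected_space X"
    and sym: "\<And>s t. R s t \<Longrightarrow> R t s"
    and trans: "\<And>s t u. R s t \<Longrightarrow> R t u \<Longrightarrow> R s u"
    and loc: "\<And>s. s \<in> topspace X \<Longrightarrow> \<exists>U. openin X U \<and> s \<in> U \<and> (\<forall>t\<in>U. R s t)"
    and st: "s \<in> topspace X" "t \<in> topspace X"
  shows "R s t"
proof -
  define T where "T = {u \<in> topspace X. R s u}"
  have "openin X T"
  proof (subst openin_subopen, intro ballI)
    fix u assume u: "u \<in> T"
    then obtain U where U: "openin X U" "u \<in> U" "\<forall>t\<in>U. R u t"
      using loc unfolding T_def by blast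
    have "U \<subseteq> T" using U u openin_subset[OF U(1)] trans unfolding T_def by blast
    then show "\<exists>U. openin X U \<and> u \<in> U \<and> U \<subseteq> T" using U by blast
  qed
  moreover have "openin X (topspace X - T)"
  proof (subst openin_subopen, intro ballI)
    fix u assume u: "u \<in> topspace X - T"
    then obtain U where U: "openin X U" "u \<in> U" "\<forall>t\<in>U. R u t"
      using loc by blast
    have "U \<subseteq> topspace X - T"
      using U u openin_subset[OF U(1)] trans sym unfolding T_def by blast
    then show "\<exists>U. openin X U \<and> u \<in> U \<and> U \<subseteq> topspace X - T" using U by blast
  qed
  ultimately have "T = {} \<or> T = topspace X"
    using X unfolding connected_space_clopen_in closedin_def T_def by blast
  \<comment> \<open>Reflexivity is not among the assumptions; it comes from \<open>loc\<close>,
    whose neighbourhood of \<open>s\<close> contains \<open>s\<close> itself.\<close>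
  moreover have "s \<in> T" using loc[OF st(1)] st unfolding T_def by blast
  ultimately show ?thesis using st unfolding T_def by blast
qed

text \<open>One side of a cut point stays connected once the cut point is added to it. If
  \<open>G\<close> and \<open>H\<close> separated \<open>S - E2\<close> with \<open>z\<close> in
  \<open>G\<close>, then \<open>G \<union> E2\<close> and \<open>H \<inter> E1\<close> would
  separate \<open>S\<close>.\<close>

lemma connectedin_diff_side:
  assumes S: "connectedin X S" and z: "z \<in> S" "z \<notin> E1" "z \<notin> E2"
    and E: "openin X E1" "openin X E2" "S - {z} \<subseteq> E1 \<union> E2" "E1 \<inter> E2 \<inter> S = {}"
  shows "connectedin X (S - E2)"
proof -
  have aux: False
    if G: "openin X G" "openin X H" "S - E2 \<subseteq> G \<union> H" "G \<inter> H \<inter> (S - E2) = {}"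
      "H \<inter> (S - E2) \<noteq> {}" and zG: "z \<in> G" for G H
  proof -
    have "openin X (G \<union> E2)" "openin X (H \<inter> E1)" using G E by auto
    moreover have zH: "z \<notin> H" using G zG z by blast
    then have "S \<subseteq> (G \<union> E2) \<union> (H \<inter> E1)" using G E zG by blast
    moreover have "(G \<union> E2) \<inter> (H \<inter> E1) \<inter> S = {}" using G E by blast
    moreover have "(G \<union> E2) \<inter> S \<noteq> {}" using zG z by blast
    moreover have "(H \<inter> E1) \<inter> S \<noteq> {}" using G zH E by blast
    ultimately show False using S unfolding connectedin by blast
  qed
  show ?thesis
    unfolding connectedin
  proof (intro conjI notI)
    show "S - E2 \<subseteq> topspace X" using connectedin_subset_topspace[OF S] by blast
    assume "\<exists>G H. openin X G \<and> openin X H \<and> S - E2 \<subseteq> G \<union> H \<and> G \<inter> H \<inter> (S - E2) = {} \<and>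
      G \<inter> (S - E2) \<noteq> {} \<and> H \<inter> (S - E2) \<noteq> {}"
    then obtain G H where G: "openin X G" "openin X H" "S - E2 \<subseteq> G \<union> H"
      "G \<inter> H \<inter> (S - E2) = {}" "G \<inter> (S - E2) \<noteq> {}" "H \<inter> (S - E2) \<noteq> {}"
      by blast
    have "z \<in> G \<or> z \<in> H" using G z by blast
    then show False
    proof
      assume "z \<in> G" then show False using aux[OF G(1-4,6)] by blast
    next
      assume zH: "z \<in> H"
      have "S - E2 \<subseteq> H \<union> G" "H \<inter> G \<inter> (S - E2) = {}" using G by blast+
      then show False using aux[OF G(2,1) _ _ G(5) zH] by blast
    qed
  qed
qed

section \<open>Chains of compact connected sets and minimal sets\<close>

lemma chain_finite_has_least:
  assumes "finite \<F>" "\<F> \<noteq> {}" "\<And>A B. A \<in> \<F> \<Longrightarrow> B \<in> \<F> \<Longrightarrow> A \<subseteq> B \<or> B \<subseteq> A"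
  shows "\<exists>M\<in>\<F>. \<forall>A\<in>\<F>. M \<subseteq> A"
  using assms
proof (induction rule: finite_ne_induct)
  case (insert B \<F>)
  then obtain M where M: "M \<in> \<F>" "\<forall>A\<in>\<F>. M \<subseteq> A" by (metis insertCI)
  have "M \<subseteq> B \<or> B \<subseteq> M" using insert.prems M(1) by blast
  then show ?case
  proof
    assume "M \<subseteq> B"
    then show ?thesis using M by (intro bexI[of _ M]) auto
  next
    assume "B \<subseteq> M"
    then show ?thesis using M by (intro bexI[of _ B]) auto
  qed
qed simp

text \<open>A separation of the intersection consists of two disjoint compact sets, which have
  disjoint open neighbourhoods \<open>G1\<close> and \<open>G2\<close>. By compactness some member
  of the chain already lies in \<open>G1 \<union> G2\<close> and would be separated too.\<close>

lemma connectedin_Inter_chain: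
  assumes X: "Hausdorff_space X" and ne: "\<C> \<noteq> {}"
    and cpt: "\<And>A. A \<in> \<C> \<Longrightarrow> compactin X A" and con: "\<And>A. A \<in> \<C> \<Longrightarrow> connectedin X A"
    and chain: "\<And>A B. A \<in> \<C> \<Longrightarrow> B \<in> \<C> \<Longrightarrow> A \<subseteq> B \<or> B \<subseteq> A"
  shows "connectedin X (\<Inter>\<C>)"
  unfolding connectedin
proof (intro conjI notI)
  obtain A0 where A0: "A0 \<in> \<C>" using ne by blast
  then show "\<Inter>\<C> \<subseteq> topspace X" using cpt compactin_subset_topspace by blast
  assume "\<exists>E1 E2. openin X E1 \<and> openin X E2 \<and> \<Inter>\<C> \<subseteq> E1 \<union> E2 \<and> E1 \<inter> E2 \<inter> \<Inter>\<C> = {} \<and>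
    E1 \<inter> \<Inter>\<C> \<noteq> {} \<and> E2 \<inter> \<Inter>\<C> \<noteq> {}"
  then obtain E1 E2 where E: "openin X E1" "openin X E2" "\<Inter>\<C> \<subseteq> E1 \<union> E2"
    "E1 \<inter> E2 \<inter> \<Inter>\<C> = {}" "E1 \<inter> \<Inter>\<C> \<noteq> {}" "E2 \<inter> \<Inter>\<C> \<noteq> {}"
    by blast
  have clo: "closedin X A" if "A \<in> \<C>" for A using compactin_imp_closedin[OF X cpt[OF that]] .
  have sub: "A \<subseteq> topspace X" if "A \<in> \<C>" for A using clo[OF that] closedin_subset by blast
  have cI: "compactin X (\<Inter>\<C>)"
    by (rule closed_compactin[OF cpt[OF A0]]) (use A0 clo ne in auto)
  have cp: "compactin X (\<Inter>\<C> - E)" if "openin X E" for E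
  proof -
    have "\<Inter>\<C> - E = (topspace X - E) \<inter> \<Inter>\<C>" using A0 sub by blast
    moreover have "closedin X (topspace X - E)" using that by blast
    ultimately show ?thesis using closed_Int_compactin[OF _ cI] by simp
  qed
  have "disjnt (\<Inter>\<C> - E2) (\<Inter>\<C> - E1)" using E(3) unfolding disjnt_def by blast
  then obtain G1 G2 where G: "openin X G1" "openin X G2" "\<Inter>\<C> - E2 \<subseteq> G1" "\<Inter>\<C> - E1 \<subseteq> G2"
    "disjnt G1 G2"
    using Hausdorff_space_compact_separation[OF X cp[OF E(2)] cp[OF E(1)]] by metis
  \<comment> \<open>An open cover of \<open>A0\<close>: a point outside the intersection is missed
    by some member of the chain, hence lies in its complement.\<close>
  define \<U> where "\<U> = insert (G1 \<union> G2) ((\<lambda>A. topspace X - A) ` \<C>)"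
  have "\<forall>U\<in>\<U>. openin X U" using G clo unfolding \<U>_def by auto
  moreover have "A0 \<subseteq> \<Union>\<U>"
  proof
    fix p assume p: "p \<in> A0"
    show "p \<in> \<Union>\<U>"
    proof (cases "p \<in> \<Inter>\<C>")
      case True
      then have "p \<in> G1 \<union> G2" using G E by blast
      then show ?thesis unfolding \<U>_def by blast
    next
      case False
      then show ?thesis using p sub[OF A0] unfolding \<U>_def by blast
    qed
  qed
  ultimately obtain \<F> where F: "finite \<F>" "\<F> \<subseteq> \<U>" "A0 \<subseteq> \<Union>\<F>"
    using cpt[OF A0] unfolding compactin_def by meson
  have "finite (\<F> - {G1 \<union> G2})" "\<F> - {G1 \<union> G2} \<subseteq> (\<lambda>A. topspace X - A) ` \<C>"
    using F(1,2) unfolding \<U>_def by auto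
  from finite_subset_image[OF this]
  obtain \<D> where D: "\<D> \<subseteq> \<C>" "finite \<D>" "\<F> - {G1 \<union> G2} = (\<lambda>A. topspace X - A) ` \<D>"
    by (elim exE conjE)
  \<comment> \<open>Inserting \<open>A0\<close> keeps the least member inside \<open>A0\<close>,
    where the finite cover applies, and keeps the family nonempty. A point of \<open>M\<close> lies
    in no complement coming from \<open>\<D>\<close>, so only \<open>G1 \<union> G2\<close> can
    cover it.\<close>
  have "\<exists>M\<in>insert A0 \<D>. \<forall>A\<in>insert A0 \<D>. M \<subseteq> A"
  proof (rule chain_finite_has_least)
    show "finite (insert A0 \<D>)" using D(2) by simp
    have "insert A0 \<D> \<subseteq> \<C>" using D(1) A0 by blast
    then show "A \<subseteq> B \<or> B \<subseteq> A" if "A \<in> insert A0 \<D>" "B \<in> insert A0 \<D>" for A B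
      using chain that by blast
  qed simp
  then obtain M where M: "M \<in> insert A0 \<D>" "\<forall>A\<in>insert A0 \<D>. M \<subseteq> A" by blast
  have MC: "M \<in> \<C>" using M D A0 by blast
  have "M \<subseteq> G1 \<union> G2"
  proof
    fix p assume p: "p \<in> M"
    then obtain U where U: "U \<in> \<F>" "p \<in> U" using M F by blast
    have "U \<notin> (\<lambda>A. topspace X - A) ` \<D>" using U(2) M(2) p by blast
    then show "p \<in> G1 \<union> G2" using D(3) U by blast
  qed
  moreover have "G1 \<inter> M \<noteq> {}" "G2 \<inter> M \<noteq> {}" using E G MC by blast+
  moreover have "G1 \<inter> G2 \<inter> M = {}" using G(5) by (auto simp: disjnt_def)
  ultimately show False using con[OF MC] G(1,2) unfolding connectedin by blast
qed

text \<open>Zorn's lemma for inclusion, applied to the complements: they turn intersections of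
  nonempty chains into unions and minimal sets into maximal ones.\<close>

lemma minimal_set_Zorn:
  assumes "\<A> \<noteq> {}"
    and ch: "\<And>\<C>. \<C> \<noteq> {} \<Longrightarrow> \<C> \<subseteq> \<A> \<Longrightarrow> (\<And>A B. A \<in> \<C> \<Longrightarrow> B \<in> \<C> \<Longrightarrow> A \<subseteq> B \<or> B \<subseteq> A)
      \<Longrightarrow> \<Inter>\<C> \<in> \<A>"
  shows "\<exists>M\<in>\<A>. \<forall>A\<in>\<A>. A \<subseteq> M \<longrightarrow> A = M"
proof -
  have "\<exists>M\<in>uminus ` \<A>. \<forall>A\<in>uminus ` \<A>. M \<subseteq> A \<longrightarrow> A = M"
  proof (rule subset_Zorn_nonempty)
    show "uminus ` \<A> \<noteq> {}" using assms(1) by blast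
    fix \<D> :: "'a set set" assume D: "\<D> \<noteq> {}" "subset.chain (uminus ` \<A>) \<D>"
    have "\<Inter>(uminus ` \<D>) \<in> \<A>"
    proof (rule ch)
      show "uminus ` \<D> \<noteq> {}" using D by blast
      show "uminus ` \<D> \<subseteq> \<A>" using D by (auto simp: subset.chain_def)
      fix A B assume "A \<in> uminus ` \<D>" "B \<in> uminus ` \<D>"
      then have "- A \<in> \<D>" "- B \<in> \<D>" by auto
      then have "- A \<subseteq> - B \<or> - B \<subseteq> - A" using D(2) unfolding subset_chain_def by blast
      then show "A \<subseteq> B \<or> B \<subseteq> A" by blast
    qed
    moreover have "\<Union>\<D> = - \<Inter>(uminus ` \<D>)" by auto
    ultimately show "\<Union>\<D> \<in> uminus ` \<A>" by blast
  qed
  then show ?thesis by auto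
qed

section \<open>Convexity spaces\<close>

lemma convex_wrt_Int: "convex_wrt c A \<Longrightarrow> convex_wrt c B \<Longrightarrow> convex_wrt c (A \<inter> B)"
  unfolding convex_wrt_def by blast

lemma convexity_space_segment:
  assumes "convexity_space U c" "x \<in> topspace U" "y \<in> topspace U"
  shows "connectedin U (c (x, y))" "x \<in> c (x, y)" "y \<in> c (x, y)" "convex_wrt c (c (x, y))"
    "\<And>B. connectedin U B \<Longrightarrow> x \<in> B \<Longrightarrow> y \<in> B \<Longrightarrow> B \<subseteq> c (x, y) \<Longrightarrow> B = c (x, y)"
proof -
  have cv: "\<forall>x\<in>topspace U. \<forall>y\<in>topspace U. convex_wrt c (c (x, y))"
    using assms(1) unfolding convexity_space_def by (elim conjE)
  have seg: "\<forall>x\<in>topspace U. \<forall>y\<in>topspace U.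
        connectedin U (c (x, y)) \<and> x \<in> c (x, y) \<and> y \<in> c (x, y) \<and>
        (\<forall>B. connectedin U B \<and> x \<in> B \<and> y \<in> B \<and> B \<subseteq> c (x, y) \<longrightarrow> B = c (x, y))"
    using assms(1) unfolding convexity_space_def by (elim conjE)
  from bspec[OF bspec[OF cv assms(2)] assms(3)] bspec[OF bspec[OF seg assms(2)] assms(3)]
  show "connectedin U (c (x, y))" "x \<in> c (x, y)" "y \<in> c (x, y)" "convex_wrt c (c (x, y))"
    "\<And>B. connectedin U B \<Longrightarrow> x \<in> B \<Longrightarrow> y \<in> B \<Longrightarrow> B \<subseteq> c (x, y) \<Longrightarrow> B = c (x, y)"
    by simp_all
qed

lemma convexity_space_basis:
  assumes "convexity_space U c" "openin U W" "z \<in> W"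
  shows "\<exists>B. openin U B \<and> convex_wrt c B \<and> z \<in> B \<and> B \<subseteq> W"
proof -
  have "openin U = arbitrary union_of (\<lambda>B. openin U B \<and> convex_wrt c B)"
    using assms(1) unfolding convexity_space_def by (elim conjE)
  then have "(arbitrary union_of (\<lambda>B. openin U B \<and> convex_wrt c B)) W"
    using assms(2) by metis
  then show ?thesis using assms(3) unfolding arbitrary_union_of_alt by blast
qed

text \<open>Any two points of \<open>A\<close> are joined inside \<open>A\<close> by their segment,
  which is connected.\<close>

lemma convex_wrt_imp_connectedin:
  assumes U: "convexity_space U c" and A: "A \<subseteq> topspace U" "convex_wrt c A"
  shows "connectedin U A"
proof -
  have "\<exists>T. connectedin (subtopology U A) T \<and> x \<in> T \<and> y \<in> T" if "x \<in> A" "y \<in> A" for x y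
    using convexity_space_segment(1-3)[OF U, of x y] that A
    unfolding convex_wrt_def connectedin_subtopology by blast
  then have "connected_space (subtopology U A)"
    unfolding connected_space_subconnected using A(1) by auto
  then show ?thesis using A(1) by (simp add: connectedin_def)
qed

section \<open>Compactness of segments and closures of convex sets\<close>

lemma compactin_segment:
  assumes U: "convexity_space U c" and xy: "x \<in> topspace U" "y \<in> topspace U"
  shows "compactin U (c (x, y))"
  unfolding compactin_def
proof (intro conjI allI impI)
  let ?S = "c (x, y)"
  note seg = convexity_space_segment[OF U xy]
  show sub: "?S \<subseteq> topspace U" using seg(1) connectedin_subset_topspace by blast
  fix \<U> assume cov: "(\<forall>G\<in>\<U>. openin U G) \<and> ?S \<subseteq> \<Union>\<U>"
  \<comment> \<open>\<open>R\<close> hides the chain of pieces: two points are related if some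
    connected part of the segment contains both and is covered by finitely many members of
    \<open>\<U>\<close>. Such parts can be joined at a common point.\<close>
  define R where "R s t \<longleftrightarrow> (\<exists>T \<F>. connectedin U T \<and> s \<in> T \<and> t \<in> T \<and> T \<subseteq> ?S \<and>
    finite \<F> \<and> \<F> \<subseteq> \<U> \<and> T \<subseteq> \<Union>\<F>)" for s t
  have "R x y"
  proof (rule connected_space_equivalence[of "subtopology U ?S" R])
    show "connected_space (subtopology U ?S)" using seg(1) by (simp add: connectedin_def)
    show "R t s" if "R s t" for s t using that unfolding R_def by blast
    show "R s u" if st: "R s t" and tu: "R t u" for s t u
    proof -
      obtain T \<F> where T: "connectedin U T" "s \<in> T" "t \<in> T" "T \<subseteq> ?S" "finite \<F>" "\<F> \<subseteq> \<U>" "T \<subseteq> \<Union>\<F>"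
        using st unfolding R_def by blast
      obtain T' \<F>' where T': "connectedin U T'" "t \<in> T'" "u \<in> T'" "T' \<subseteq> ?S" "finite \<F>'" "\<F>' \<subseteq> \<U>"
        "T' \<subseteq> \<Union>\<F>'"
        using tu unfolding R_def by blast
      have "connectedin U (T \<union> T')" using connectedin_Un T T' by blast
      then show "R s u" unfolding R_def using T T'
        by (intro exI[of _ "T \<union> T'"] exI[of _ "\<F> \<union> \<F>'"]) auto
    qed
    show "\<exists>B. openin (subtopology U ?S) B \<and> s \<in> B \<and> (\<forall>t\<in>B. R s t)"
      if "s \<in> topspace (subtopology U ?S)" for s
    proof -
      have s: "s \<in> ?S" using that by simp
      then obtain G where G: "G \<in> \<U>" "s \<in> G" using cov by blast
      then obtain B where B: "openin U B" "convex_wrt c B" "s \<in> B" "B \<subseteq> G"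
        using convexity_space_basis[OF U, of G s] cov by blast
      \<comment> \<open>Basic open sets can be taken convex and the segment is convex, so this trace
        is convex and therefore connected; the single set \<open>G\<close> covers it.\<close>
      have "connectedin U (?S \<inter> B)"
        by (rule convex_wrt_imp_connectedin[OF U]) (use sub convex_wrt_Int[OF seg(4) B(2)] in auto)
      then have "\<forall>t\<in>?S \<inter> B. R s t" unfolding R_def using s B G
        by (intro ballI exI[of _ "?S \<inter> B"] exI[of _ "{G}"]) auto
      moreover have "openin (subtopology U ?S) (?S \<inter> B)"
        using B(1) by (simp add: openin_subtopology_Int2)
      ultimately show ?thesis using s B(3) by blast
    qed
    show "x \<in> topspace (subtopology U ?S)" "y \<in> topspace (subtopology U ?S)" using seg(2,3) xy by auto
  qed
  \<comment> \<open>Minimality of the segment: a connected part that contains both \<open>x\<close>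
    and \<open>y\<close> is all of it, so its finite cover is the required one.\<close>
  then show "\<exists>\<F>. finite \<F> \<and> \<F> \<subseteq> \<U> \<and> ?S \<subseteq> \<Union>\<F>" using seg(5) unfolding R_def by metis
qed

text \<open>Continuity into the power topology is upper semicontinuity: \<open>Pow G\<close> is a
  basic open set, and its preimage contains a box around \<open>(x, y)\<close>.\<close>

lemma convexity_space_upper_semicontinuous:
  assumes U: "convexity_space U c" and xy: "x \<in> topspace U" "y \<in> topspace U"
    and G: "openin U G" "c (x, y) \<subseteq> G"
  obtains Ux Uy where "openin U Ux" "openin U Uy" "x \<in> Ux" "y \<in> Uy"
    "\<And>x' y'. x' \<in> Ux \<Longrightarrow> y' \<in> Uy \<Longrightarrow> c (x', y') \<subseteq> G"
proof -
  have c: "continuous_map (prod_topology U U) (power_topology U) c"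
    using U unfolding convexity_space_def by (elim conjE)
  have PG: "openin (power_topology U) (Pow G)"
    unfolding power_topology_def using G(1) by (intro topology_generated_by_Basis) blast
  define N where "N = {p \<in> topspace (prod_topology U U). c p \<in> Pow G}"
  have openN: "openin (prod_topology U U) N"
    using openin_continuous_map_preimage[OF c PG] unfolding N_def .
  have "(x, y) \<in> N" using xy G(2) unfolding N_def by simp
  from openN[unfolded openin_prod_topology_alt, rule_format, OF this]
  obtain Ux Uy where Uxy: "openin U Ux" "openin U Uy" "x \<in> Ux" "y \<in> Uy" "Ux \<times> Uy \<subseteq> N"
    by (elim exE conjE)
  have "c (x', y') \<subseteq> G" if "x' \<in> Ux" "y' \<in> Uy" for x' y'
    using that Uxy(5) unfolding N_def by auto
  then show thesis using that Uxy(1-4) by simp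
qed

text \<open>
  A point \<open>z\<close> of \<open>c (x, y)\<close> cuts it between \<open>x\<close> and \<open>y\<close>. If \<open>z\<close> were outside the closure of \<open>A\<close>,
  the segments between points of \<open>A\<close> close to \<open>x\<close> and \<open>y\<close> would be torn apart there.
\<close>

lemma convex_wrt_closure_of:
  assumes U: "convexity_space U c" and A: "A \<subseteq> topspace U" "convex_wrt c A"
  shows "convex_wrt c (U closure_of A)"
  unfolding convex_wrt_def
proof (intro ballI subsetI, rule ccontr)
  fix x y z assume xA: "x \<in> U closure_of A" and yA: "y \<in> U closure_of A" and zS: "z \<in> c (x, y)"
    and zA: "z \<notin> U closure_of A"
  define S where "S = c (x, y)"
  define W where "W = topspace U - U closure_of A"
  have H: "Hausdorff_space U" using U unfolding convexity_space_def by (elim conjE)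
  have xy: "x \<in> topspace U" "y \<in> topspace U" using xA yA by (auto simp: in_closure_of)
  note seg = convexity_space_segment[OF U xy, folded S_def]
  have sub: "S \<subseteq> topspace U" using seg(1) connectedin_subset_topspace by blast
  have W: "openin U W" "z \<in> W" "x \<notin> W" "y \<notin> W" "W \<inter> A = {}"
    using zS sub zA xA yA closure_of_subset[OF A(1)] unfolding W_def S_def by auto
  \<comment> \<open>The end points avoid \<open>W\<close> and so differ from \<open>z\<close>.
    Removing \<open>z\<close> leaves both in place, and minimality of the segment forces a
    disconnection.\<close>
  have "S - {z} \<noteq> S" using zS unfolding S_def by blast
  then have "\<not> connectedin U (S - {z})" using seg(5)[of "S - {z}"] seg(2,3) W by blast
  then obtain D1 D2 where D: "openin U D1" "openin U D2" "S - {z} \<subseteq> D1 \<union> D2"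
    "D1 \<inter> D2 \<inter> (S - {z}) = {}" "D1 \<inter> (S - {z}) \<noteq> {}" "D2 \<inter> (S - {z}) \<noteq> {}"
    using sub unfolding connectedin by blast
  \<comment> \<open>\<open>D1\<close> and \<open>D2\<close> are disjoint only on
    \<open>S - {z}\<close>. Deleting \<open>z\<close> makes the traces disjoint on all of
    \<open>S\<close> and preserves openness, since points are closed.\<close>
  define E1 where "E1 = D1 - {z}"
  define E2 where "E2 = D2 - {z}"
  have E: "openin U E1" "openin U E2" "S - {z} \<subseteq> E1 \<union> E2" "E1 \<inter> E2 \<inter> S = {}"
    "E1 \<inter> S \<noteq> {}" "E2 \<inter> S \<noteq> {}" "z \<notin> E1" "z \<notin> E2"
    using D open_in_Hausdorff_delete[OF H] unfolding E1_def E2_def by auto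
  have zS': "z \<in> S" using zS unfolding S_def .
  have "connectedin U (S - E2)"
    using connectedin_diff_side[OF seg(1) zS' E(7,8,1-4)] .
  \<comment> \<open>\<open>S - E2\<close> is connected and proper, so by minimality it misses an end
    point. With the same argument for \<open>E1\<close>, each of the two sides contains exactly one
    end point.\<close>
  then have n2: "\<not> (x \<notin> E2 \<and> y \<notin> E2)" using seg(5)[of "S - E2"] seg(2,3) E by blast
  have "S - {z} \<subseteq> E2 \<union> E1" "E2 \<inter> E1 \<inter> S = {}" using E by auto
  then have "connectedin U (S - E1)"
    using connectedin_diff_side[OF seg(1) zS' E(8,7,2,1)] by blast
  then have n1: "\<not> (x \<notin> E1 \<and> y \<notin> E1)" using seg(5)[of "S - E1"] seg(2,3) E by blast
  \<comment> \<open>Only \<open>z\<close> lies in neither \<open>E1\<close> nor \<open>E2\<close>,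
    and \<open>W\<close> contains \<open>z\<close>. So \<open>S - W\<close> splits into the disjoint
    compact sets \<open>S - W - E2\<close> and \<open>S - W - E1\<close>, which have disjoint open
    neighbourhoods.\<close>
  have cp: "compactin U (S - W - E)" if "openin U E" for E
  proof -
    have "S - W - E = (topspace U - (W \<union> E)) \<inter> S" using sub by blast
    moreover have "closedin U (topspace U - (W \<union> E))" using that W(1) by blast
    ultimately show ?thesis
      using closed_Int_compactin[OF _ compactin_segment[OF U xy]] unfolding S_def by simp
  qed
  have "disjnt (S - W - E2) (S - W - E1)" using E(3) W(2) unfolding disjnt_def by blast
  then obtain G1 G2 where G: "openin U G1" "openin U G2" "S - W - E2 \<subseteq> G1" "S - W - E1 \<subseteq> G2"
    "disjnt G1 G2"
    using Hausdorff_space_compact_separation[OF H cp[OF E(2)] cp[OF E(1)]] by metis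
  have xyG: "x \<in> G1 \<and> y \<in> G2 \<or> x \<in> G2 \<and> y \<in> G1"
    using n1 n2 E(4) G(3,4) seg(2,3) W(3,4) by blast
  have SG: "S \<subseteq> G1 \<union> G2 \<union> W" using G(3,4) E(4) by blast
  obtain Ux Uy where Uxy: "openin U Ux" "openin U Uy" "x \<in> Ux" "y \<in> Uy"
    "\<And>x' y'. x' \<in> Ux \<Longrightarrow> y' \<in> Uy \<Longrightarrow> c (x', y') \<subseteq> G1 \<union> G2 \<union> W"
    by (rule convexity_space_upper_semicontinuous[OF U xy, of "G1 \<union> G2 \<union> W"])
      (use SG G(1,2) W(1) S_def in auto)
  \<comment> \<open>\<open>P\<close> and \<open>Q\<close> stand for \<open>G1\<close> and
    \<open>G2\<close> in either order, according to the side on which \<open>x\<close> lies. For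
    points \<open>x'\<close> and \<open>y'\<close> of \<open>A\<close> close to \<open>x\<close> and
    \<open>y\<close>, the segment lies in \<open>A\<close>, which misses \<open>W\<close>; so
    \<open>P\<close> and \<open>Q\<close> separate it.\<close>
  have near: False if PQ: "openin U P" "openin U Q" "x \<in> P" "y \<in> Q" "P \<inter> Q = {}" "P \<union> Q = G1 \<union> G2" for P Q
  proof -
    obtain x' where x': "x' \<in> A" "x' \<in> Ux \<inter> P"
      using xA Uxy(1,3) PQ(1,3) openin_Int[of U Ux P] unfolding in_closure_of by blast
    obtain y' where y': "y' \<in> A" "y' \<in> Uy \<inter> Q"
      using yA Uxy(2,4) PQ(2,4) openin_Int[of U Uy Q] unfolding in_closure_of by blast
    have s: "connectedin U (c (x', y'))" "x' \<in> c (x', y')" "y' \<in> c (x', y')"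
      using convexity_space_segment(1-3)[OF U subsetD[OF A(1) x'(1)] subsetD[OF A(1) y'(1)]] .
    have "c (x', y') \<subseteq> A" using A(2) x' y' unfolding convex_wrt_def by blast
    then have "c (x', y') \<subseteq> P \<union> Q" using Uxy(5)[of x' y'] x' y' W(5) PQ(6) by blast
    then show False using s x' y' PQ(1,2,5) unfolding connectedin by blast
  qed
  show False using xyG near[of G1 G2] near[of G2 G1] G unfolding disjnt_def by blast
qed

section \<open>Local convexity structures\<close>

lemma local_convexity_structureD:
  assumes "local_convexity_structure Y \<V>" "(V, c) \<in> \<V>"
  shows "openin Y V" "convexity_space (subtopology Y V) c"
  using assms unfolding local_convexity_structure_def by auto

lemma chart_segment:
  assumes Y: "local_convexity_structure Y \<V>" "(V, c) \<in> \<V>" and xy: "x \<in> V" "y \<in> V"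
  shows "connectedin Y (c (x, y))" "x \<in> c (x, y)" "y \<in> c (x, y)" "c (x, y) \<subseteq> V"
proof -
  note V = local_convexity_structureD[OF Y]
  have "topspace (subtopology Y V) = V" using openin_subset[OF V(1)] by auto
  then show "connectedin Y (c (x, y))" "x \<in> c (x, y)" "y \<in> c (x, y)" "c (x, y) \<subseteq> V"
    using convexity_space_segment[OF V(2), of x y] xy by (auto simp: connectedin_subtopology)
qed

lemma convex_inI:
  assumes "A \<subseteq> topspace Y"
    and "\<And>V c. (V, c) \<in> \<V> \<Longrightarrow> convex_wrt c (A \<inter> V)"
  shows "convex_in Y \<V> A"
  using assms unfolding convex_in_def by blast

lemma convex_inD:
  assumes "convex_in Y \<V> A" "(V, c) \<in> \<V>"
  shows "convex_wrt c (A \<inter> V)"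
  using assms unfolding convex_in_def by blast

lemma convex_in_hull:
  assumes Y: "local_convexity_structure Y \<V>" and F: "F \<subseteq> topspace Y"
  shows "convex_in Y \<V> (convex_in Y \<V> hull F)"
proof -
  \<comment> \<open>The hull is an intersection of convex supersets; the whole space is one of them,
    which keeps the hull inside \<open>topspace Y\<close>.\<close>
  have top: "convex_in Y \<V> (topspace Y)"
    unfolding convex_in_def convex_wrt_def using chart_segment(4)[OF Y]
      local_convexity_structureD(1)[OF Y, THEN openin_subset] by fast
  show ?thesis
  proof (rule convex_inI)
    show "convex_in Y \<V> hull F \<subseteq> topspace Y" by (rule hull_minimal) (use F top in auto)
    fix V c assume V: "(V, c) \<in> \<V>"
    show "convex_wrt c (convex_in Y \<V> hull F \<inter> V)"
      unfolding convex_wrt_def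
    proof (intro ballI)
      fix x y assume h: "x \<in> convex_in Y \<V> hull F \<inter> V" "y \<in> convex_in Y \<V> hull F \<inter> V"
      have "c (x, y) \<subseteq> T" if T: "convex_in Y \<V> T" "F \<subseteq> T" for T
      proof -
        have "x \<in> T \<inter> V" "y \<in> T \<inter> V" using h T unfolding hull_def by auto
        then show ?thesis using convex_inD[OF T(1) V] unfolding convex_wrt_def by blast
      qed
      then show "c (x, y) \<subseteq> convex_in Y \<V> hull F \<inter> V"
        using chart_segment(4)[OF Y V, of x y] h unfolding hull_def by blast
    qed
  qed
qed

text \<open>Charts are open, so taking the closure commutes with restriction to a chart, and the
  claim reduces to \<open>convex_wrt_closure_of\<close> in each chart.\<close>

lemma convex_in_closure_of:
  assumes Y: "local_convexity_structure Y \<V>" and A: "convex_in Y \<V> A"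
  shows "convex_in Y \<V> (Y closure_of A)"
proof -
  have "convex_wrt c (Y closure_of A \<inter> V)" if V: "(V, c) \<in> \<V>" for V c
  proof -
    note VD = local_convexity_structureD[OF Y V]
    have "convex_wrt c (A \<inter> V)" using convex_inD[OF A V] .
    then have "convex_wrt c (subtopology Y V closure_of (A \<inter> V))"
      by (rule convex_wrt_closure_of[OF VD(2), rotated]) (use openin_subset[OF VD(1)] in auto)
    moreover have "subtopology Y V closure_of (A \<inter> V) = Y closure_of A \<inter> V"
      using openin_Int_closure_of_eq[OF VD(1), of A] VD(1)
      by (auto simp: closure_of_subtopology_open Int_commute)
    ultimately show ?thesis by simp
  qed
  then show ?thesis by (intro convex_inI closure_of_subset_topspace)
qed

lemma locally_convex_inD:
  assumes "locally_convex_in Y \<V> A" "z \<in> A"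
  obtains V c where "(V, c) \<in> \<V>" "z \<in> V" "convex_wrt c (A \<inter> V)"
  using assms unfolding locally_convex_in_def by blast

text \<open>\<open>B\<close> is a finite chain of segments and \<open>F\<close> the set of its
  vertices. The containment in the hull of the finite set \<open>F\<close> is recorded because it is
  the closures of such hulls that are known to be compact.\<close>

lemma connected_locally_convex_chain:
  assumes Y: "local_convexity_structure Y \<V>" and C: "connectedin Y C" "locally_convex_in Y \<V> C"
    and ab: "a \<in> C" "b \<in> C"
  obtains F B where "finite F" "F \<subseteq> C" "connectedin Y B" "a \<in> B" "b \<in> B" "B \<subseteq> C"
    "B \<subseteq> convex_in Y \<V> hull F"
proof -
  let ?hull = "\<lambda>F. convex_in Y \<V> hull F"
  have CY: "C \<subseteq> topspace Y" using C(1) connectedin_subset_topspace by blast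
  define R where "R s t \<longleftrightarrow> (\<exists>F B. finite F \<and> F \<subseteq> C \<and> connectedin Y B \<and> s \<in> B \<and> t \<in> B \<and> B \<subseteq> C \<and>
    B \<subseteq> ?hull F)" for s t
  have "R a b"
  proof (rule connected_space_equivalence[of "subtopology Y C" R])
    show "connected_space (subtopology Y C)" using C(1) by (simp add: connectedin_def)
    show "R t s" if "R s t" for s t using that unfolding R_def by blast
    show "R s u" if st: "R s t" and tu: "R t u" for s t u
    proof -
      obtain F B where B: "finite F" "F \<subseteq> C" "connectedin Y B" "s \<in> B" "t \<in> B" "B \<subseteq> C" "B \<subseteq> ?hull F"
        using st unfolding R_def by blast
      obtain F' B' where B': "finite F'" "F' \<subseteq> C" "connectedin Y B'" "t \<in> B'" "u \<in> B'" "B' \<subseteq> C"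
        "B' \<subseteq> ?hull F'"
        using tu unfolding R_def by blast
      have "connectedin Y (B \<union> B')" using connectedin_Un B B' by blast
      moreover have "?hull F \<subseteq> ?hull (F \<union> F')" "?hull F' \<subseteq> ?hull (F \<union> F')" by (simp_all add: hull_mono)
      then have "B \<union> B' \<subseteq> ?hull (F \<union> F')" using B(7) B'(7) by blast
      ultimately show "R s u" unfolding R_def using B(1,2,4,6) B'(1,2,5,6)
        by (intro exI[of _ "F \<union> F'"] exI[of _ "B \<union> B'"] conjI) simp_all
    qed
    show "\<exists>U. openin (subtopology Y C) U \<and> s \<in> U \<and> (\<forall>t\<in>U. R s t)"
      if "s \<in> topspace (subtopology Y C)" for s
    proof -
      have s: "s \<in> C" using that by simp
      obtain V c where V: "(V, c) \<in> \<V>" "s \<in> V" "convex_wrt c (C \<inter> V)"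
        using locally_convex_inD[OF C(2) s] .
      \<comment> \<open>One link of the chain: the segment \<open>c (s, t)\<close> lies in
        \<open>C\<close> because \<open>C \<inter> V\<close> is convex, and in the hull of
        \<open>{s, t}\<close> because the hull is convex in the chart.\<close>
      have "R s t" if t: "t \<in> C \<inter> V" for t
      proof -
        have st: "{s, t} \<subseteq> ?hull {s, t}" by (rule hull_subset)
        have "{s, t} \<subseteq> topspace Y" using s t CY by blast
        then have "convex_wrt c (?hull {s, t} \<inter> V)"
          using convex_inD[OF convex_in_hull[OF Y] V(1)] by blast
        then have "c (s, t) \<subseteq> ?hull {s, t} \<inter> V"
          using st V(2) t unfolding convex_wrt_def by blast
        moreover have "c (s, t) \<subseteq> C \<inter> V" using V s t unfolding convex_wrt_def by blast
        ultimately show ?thesis unfolding R_def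
          using chart_segment[OF Y V(1,2), of t] s t
          by (intro exI[of _ "{s, t}"] exI[of _ "c (s, t)"] conjI) simp_all
      qed
      moreover have "openin (subtopology Y C) (C \<inter> V)"
        using local_convexity_structureD(1)[OF Y V(1)] by (simp add: openin_subtopology_Int2)
      ultimately show ?thesis using s V(2) by blast
    qed
  qed (use ab CY in auto)
  then show thesis using that unfolding R_def by blast
qed

section \<open>Geodesics as inclusions of minimal sets\<close>

text \<open>The convexity condition of \<open>generated_by\<close>, for the inclusion of
  \<open>C\<close>. The test pieces \<open>U\<close> are those of the fixed set \<open>C\<close> and
  do not vary with \<open>A\<close>, so the condition survives intersections and suits Zorn's
  lemma.\<close>

definition convex_pieces :: "'a topology \<Rightarrow> 'a chart set \<Rightarrow> 'a set \<Rightarrow> 'a set \<Rightarrow> bool" where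
  "convex_pieces Y \<V> C A \<longleftrightarrow> (\<forall>U V c. (V, c) \<in> \<V> \<and> openin (subtopology Y C) U \<and> U \<subseteq> V \<and>
     convex_wrt c U \<longrightarrow> convex_wrt c (U \<inter> A))"

text \<open>For an inclusion the homeomorphism clause is automatic, since \<open>U\<close> inherits
  the same topology from \<open>A\<close> and from \<open>Y\<close>.\<close>

lemma etale_chart_inclusion:
  assumes "A \<subseteq> topspace Y"
  shows "etale_chart Y (subtopology Y A) id U (V, c) \<longleftrightarrow>
    openin (subtopology Y A) U \<and> U \<subseteq> V \<and> convex_wrt c U"
proof -
  have "subtopology (subtopology Y A) U = subtopology Y U" if "openin (subtopology Y A) U"
    using openin_subset[OF that] by (simp add: subtopology_subtopology Int_absorb1)
  then show ?thesis unfolding etale_chart_def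
    by (auto simp del: homeomorphic_map_id simp: homeomorphic_map_id[unfolded id_def] id_def)
qed

lemma convex_pieces_Inter:
  assumes "\<C> \<noteq> {}" "\<And>A. A \<in> \<C> \<Longrightarrow> convex_pieces Y \<V> C A"
  shows "convex_pieces Y \<V> C (\<Inter>\<C>)"
  unfolding convex_pieces_def
proof (intro allI impI)
  fix U V c
  assume "(V, c) \<in> \<V> \<and> openin (subtopology Y C) U \<and> U \<subseteq> V \<and> convex_wrt c U"
  then have "convex_wrt c (U \<inter> A)" if "A \<in> \<C>" for A
    using assms(2)[OF that] unfolding convex_pieces_def by blast
  then show "convex_wrt c (U \<inter> \<Inter>\<C>)" using assms(1) unfolding convex_wrt_def by blast
qed

text \<open>The segment between two points of the component in \<open>U\<close> stays in
  \<open>U\<close> and, by convexity of \<open>K\<close>, in \<open>K\<close>. It is a connected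
  subset of \<open>C \<inter> K\<close>, so it cannot leave the component.\<close>

lemma convex_pieces_component:
  assumes Y: "local_convexity_structure Y \<V>" and K: "convex_in Y \<V> K"
  shows "convex_pieces Y \<V> C (connected_component_of_set (subtopology Y (C \<inter> K)) a)"
  unfolding convex_pieces_def
proof (intro allI impI)
  fix U V c
  assume "(V, c) \<in> \<V> \<and> openin (subtopology Y C) U \<and> U \<subseteq> V \<and> convex_wrt c U"
  then have V: "(V, c) \<in> \<V>" and U: "openin (subtopology Y C) U" "U \<subseteq> V" "convex_wrt c U" by auto
  let ?D = "connected_component_of_set (subtopology Y (C \<inter> K)) a"
  have UC: "U \<subseteq> C" using openin_subset[OF U(1)] by auto
  have KV: "convex_wrt c (K \<inter> V)" using convex_inD[OF K V] .
  show "convex_wrt c (U \<inter> ?D)"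
    unfolding convex_wrt_def
  proof (intro ballI)
    fix x y assume x: "x \<in> U \<inter> ?D" and y: "y \<in> U \<inter> ?D"
    have "?D \<subseteq> C \<inter> K"
      using connected_component_of_subset_topspace[of "subtopology Y (C \<inter> K)" a] by auto
    then have xK: "x \<in> K \<inter> V" "y \<in> K \<inter> V" using x y U(2) by auto
    have "c (x, y) \<subseteq> U" using U(3) x y unfolding convex_wrt_def by blast
    moreover have "c (x, y) \<subseteq> K" using KV xK unfolding convex_wrt_def by blast
    moreover note s = chart_segment[OF Y V, of x y]
    ultimately have con: "connectedin (subtopology Y (C \<inter> K)) (c (x, y))"
      using UC xK by (auto simp: connectedin_subtopology)
    have "c (x, y) \<subseteq> connected_component_of_set (subtopology Y (C \<inter> K)) x"
      using connected_component_of_maximal[OF con] s xK by blast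
    also have "\<dots> = ?D" using x connected_component_of_equiv[of "subtopology Y (C \<inter> K)" a x] by simp
    finally show "c (x, y) \<subseteq> U \<inter> ?D" using \<open>c (x, y) \<subseteq> U\<close> by blast
  qed
qed

text \<open>Local convexity of \<open>C\<close> provides the etale charts, compactness of
  \<open>A\<close> makes the inclusion closed, and minimality of \<open>A\<close> is generation by
  \<open>{a, b}\<close>, once the pieces of \<open>C\<close> are compared with those of
  \<open>A\<close>.\<close>

lemma geodesic_minimal_inclusion:
  assumes Y: "Hausdorff_space Y" "local_convexity_structure Y \<V>" and C: "locally_convex_in Y \<V> C"
    and A: "compactin Y A" "connectedin Y A" "A \<subseteq> C" "convex_pieces Y \<V> C A" "a \<in> A" "b \<in> A"
    and min: "\<And>B. closedin Y B \<Longrightarrow> connectedin Y B \<Longrightarrow> B \<subseteq> A \<Longrightarrow> a \<in> B \<Longrightarrow> b \<in> B \<Longrightarrow>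
      convex_pieces Y \<V> C B \<Longrightarrow> B = A"
  shows "geodesic Y \<V> (subtopology Y A) id a b"
proof -
  have AY: "A \<subseteq> topspace Y" and clo: "closedin Y A"
    using A(1) compactin_subset_topspace compactin_imp_closedin[OF Y(1)] by blast+
  note chart = etale_chart_inclusion[OF AY]
  have "z \<in> \<Union>(etale_cover Y \<V> (subtopology Y A) id)" if z: "z \<in> A" for z
  proof -
    obtain V c where V: "(V, c) \<in> \<V>" "z \<in> V" "convex_wrt c (C \<inter> V)"
      using locally_convex_inD[OF C subsetD[OF A(3) z]] .
    have op: "openin Y V" using local_convexity_structureD(1)[OF Y(2) V(1)] .
    then have "openin (subtopology Y C) (C \<inter> V)" by (simp add: openin_subtopology_Int2)
    \<comment> \<open>\<open>C \<inter> V\<close> is itself a convex piece of \<open>C\<close>, so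
      its trace on \<open>A\<close> is convex.\<close>
    then have "convex_wrt c ((C \<inter> V) \<inter> A)"
      using A(4) V unfolding convex_pieces_def by blast
    moreover have "(C \<inter> V) \<inter> A = A \<inter> V" using A(3) by blast
    ultimately have "etale_chart Y (subtopology Y A) id (A \<inter> V) (V, c)"
      unfolding chart using op by (simp add: openin_subtopology_Int2)
    then show ?thesis using V z unfolding etale_cover_def by blast
  qed
  moreover have "\<Union>(etale_cover Y \<V> (subtopology Y A) id) \<subseteq> A"
  proof (rule Union_least)
    fix U assume "U \<in> etale_cover Y \<V> (subtopology Y A) id"
    then have "openin (subtopology Y A) U" unfolding etale_cover_def etale_chart_def by auto
    then show "U \<subseteq> A" using openin_subset by fastforce
  qed
  ultimately have cover: "\<Union>(etale_cover Y \<V> (subtopology Y A) id) = topspace (subtopology Y A)"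
    using AY by auto
  have closed: "closed_map (subtopology Y A) Y id"
    unfolding closed_map_def using clo closedin_closed_subtopology by fastforce
  have gen: "generated_by Y \<V> (subtopology Y A) id {a, b}"
    unfolding generated_by_def
  proof (intro conjI notI)
    show "{a, b} \<subseteq> topspace (subtopology Y A)" using A AY by auto
    assume "\<exists>B. closedin (subtopology Y A) B \<and> connectedin (subtopology Y A) B \<and>
      B \<subset> topspace (subtopology Y A) \<and> {a, b} \<subseteq> B \<and>
      (\<forall>U. \<forall>(V, c)\<in>\<V>. etale_chart Y (subtopology Y A) id U (V, c) \<longrightarrow> convex_wrt c (id ` (U \<inter> B)))"
    then obtain B where B: "closedin (subtopology Y A) B" "connectedin (subtopology Y A) B"
      "B \<subset> topspace (subtopology Y A)" "{a, b} \<subseteq> B"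
      and cv: "\<forall>U. \<forall>(V, c)\<in>\<V>. etale_chart Y (subtopology Y A) id U (V, c) \<longrightarrow>
        convex_wrt c (id ` (U \<inter> B))"
      by (elim exE conjE)
    have BA: "B \<subset> A" using B(3) AY by auto
    have "convex_pieces Y \<V> C B"
      unfolding convex_pieces_def
    proof (intro allI impI)
      fix U V c
      assume U: "(V, c) \<in> \<V> \<and> openin (subtopology Y C) U \<and> U \<subseteq> V \<and> convex_wrt c U"
      \<comment> \<open>A piece \<open>U\<close> of \<open>C\<close> restricts to the piece
        \<open>U \<inter> A\<close> of \<open>A\<close>, which is convex by the property of
        \<open>A\<close>. The condition on \<open>B\<close>, known for charts of \<open>A\<close>,
        therefore passes to the pieces of \<open>C\<close>.\<close>
      then obtain T where T: "openin Y T" "U = T \<inter> C" unfolding openin_subtopology by blast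
      have "U \<inter> A = A \<inter> T" using T A(3) by blast
      then have "openin (subtopology Y A) (U \<inter> A)" using T(1) by (simp add: openin_subtopology_Int2)
      moreover have "convex_wrt c (U \<inter> A)" using A(4) U unfolding convex_pieces_def by blast
      ultimately have "etale_chart Y (subtopology Y A) id (U \<inter> A) (V, c)"
        unfolding chart using U by blast
      then have "convex_wrt c (id ` (U \<inter> A \<inter> B))"
        using cv U by fast
      moreover have "id ` (U \<inter> A \<inter> B) = U \<inter> B" using BA by auto
      ultimately show "convex_wrt c (U \<inter> B)" by simp
    qed
    moreover have "closedin Y B" using B(1) clo closedin_closed_subtopology by blast
    moreover have "connectedin Y B" using B(2) by (simp add: connectedin_subtopology)
    ultimately have "B = A" using min BA B(4) by blast
    then show False using BA by blast
  qed
  show ?thesis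
    unfolding geodesic_def etale_map_def
    using A(1,2) Y(1) cover closed gen
    by (auto simp: compact_space_subtopology Hausdorff_space_subtopology connectedin_def
        continuous_map_from_subtopology)
qed

theorem mainTheorem6:
  fixes Y :: "'a topology" and \<V> :: "'a chart set" and C :: "'a set"
  assumes "geodesic_manifold Y \<V>"
    and "closedin Y C"
    and "connectedin Y C"
    and "locally_convex_in Y \<V> C"
  shows "weakly_convex_in Y \<V> C"
proof (rule weakly_convex_inI)
  have H: "Hausdorff_space Y" and Y: "local_convexity_structure Y \<V>"
    and G1: "\<And>F. finite F \<Longrightarrow> F \<subseteq> topspace Y \<Longrightarrow>
      compactin Y (Y closure_of (convex_in Y \<V> hull F))"
    using assms(1) unfolding geodesic_manifold_def by simp_all
  show CY: "C \<subseteq> topspace Y" using assms(2) closedin_subset by blast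
  fix a b assume ab: "a \<in> C" "b \<in> C"
  obtain F B where F: "finite F" "F \<subseteq> C" and B: "connectedin Y B" "a \<in> B" "b \<in> B" "B \<subseteq> C"
    "B \<subseteq> convex_in Y \<V> hull F"
    using connected_locally_convex_chain[OF Y assms(3,4) ab] .
  define K where "K = Y closure_of (convex_in Y \<V> hull F)"
  \<comment> \<open>The component is taken because \<open>C \<inter> K\<close> may be disconnected;
    the connected chain \<open>B\<close> through \<open>a\<close> and \<open>b\<close> lies in
    \<open>C \<inter> K\<close>, which puts \<open>b\<close> into \<open>D\<close>.\<close>
  define D where "D = connected_component_of_set (subtopology Y (C \<inter> K)) a"
  have FY: "F \<subseteq> topspace Y" using F CY by blast
  have K: "compactin Y K" "convex_in Y \<V> K"
    using G1[OF F(1) FY] convex_in_closure_of[OF Y convex_in_hull[OF Y FY]] unfolding K_def by auto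
  have "convex_in Y \<V> hull F \<subseteq> topspace Y"
    using convex_in_hull[OF Y FY] by (subst (asm) convex_in_def) (elim conjE)
  then have "B \<subseteq> K" using B(5) closure_of_subset unfolding K_def by blast
  then have "connectedin (subtopology Y (C \<inter> K)) B" using B by (simp add: connectedin_subtopology)
  then have abD: "a \<in> D" "b \<in> D"
    using B(2,3) unfolding D_def connected_component_of_def by blast+
  \<comment> \<open>Closedness of \<open>C\<close> enters here.\<close>
  have "compactin Y (C \<inter> K)" using closed_Int_compactin[OF assms(2) K(1)] .
  then have D: "compactin Y D"
    using closedin_connected_component_of[of "subtopology Y (C \<inter> K)" a]
    unfolding D_def by (metis closedin_compact_space compact_space_subtopology compactin_subtopology)
  have conD: "connectedin Y D"
    using connectedin_connected_component_of[of "subtopology Y (C \<inter> K)" a]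
    unfolding D_def by (simp add: connectedin_subtopology)
  have DC: "D \<subseteq> C"
    using connected_component_of_subset_topspace[of "subtopology Y (C \<inter> K)" a] unfolding D_def by auto
  have pD: "convex_pieces Y \<V> C D" unfolding D_def by (rule convex_pieces_component[OF Y K(2)])
  \<comment> \<open>The candidates for Zorn's lemma; \<open>D\<close> shows that there is one.
    Compactness is demanded so that intersections of chains remain connected.\<close>
  define \<A> where "\<A> = {A. compactin Y A \<and> connectedin Y A \<and> A \<subseteq> C \<and> a \<in> A \<and> b \<in> A \<and>
    convex_pieces Y \<V> C A}"
  have "\<exists>A\<in>\<A>. \<forall>A'\<in>\<A>. A' \<subseteq> A \<longrightarrow> A' = A"
  proof (rule minimal_set_Zorn)
    show "\<A> \<noteq> {}" using D conD DC abD pD unfolding \<A>_def by blast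
    fix \<C> :: "'a set set" assume ne: "\<C> \<noteq> {}" and sub: "\<C> \<subseteq> \<A>"
      and ch: "\<And>A B. A \<in> \<C> \<Longrightarrow> B \<in> \<C> \<Longrightarrow> A \<subseteq> B \<or> B \<subseteq> A"
    have cpt: "compactin Y A" if "A \<in> \<C>" for A using sub that unfolding \<A>_def by blast
    obtain A0 where A0: "A0 \<in> \<C>" using ne by blast
    have "compactin Y (\<Inter>\<C>)"
      by (rule closed_compactin[OF cpt[OF A0]]) (use A0 compactin_imp_closedin[OF H cpt] ne in auto)
    moreover have "connectedin Y (\<Inter>\<C>)"
      by (rule connectedin_Inter_chain[OF H ne cpt _ ch]) (use sub in \<open>auto simp: \<A>_def\<close>)
    moreover have "convex_pieces Y \<V> C (\<Inter>\<C>)"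
      by (rule convex_pieces_Inter[OF ne]) (use sub in \<open>auto simp: \<A>_def\<close>)
    moreover have "\<Inter>\<C> \<subseteq> C" "a \<in> \<Inter>\<C>" "b \<in> \<Inter>\<C>" using sub A0 unfolding \<A>_def by blast+
    ultimately show "\<Inter>\<C> \<in> \<A>" unfolding \<A>_def by blast
  qed
  then obtain A where AA: "A \<in> \<A>" and min: "\<forall>A'\<in>\<A>. A' \<subseteq> A \<longrightarrow> A' = A"
    by (elim bexE)
  have A: "compactin Y A" "connectedin Y A" "A \<subseteq> C" "convex_pieces Y \<V> C A" "a \<in> A" "b \<in> A"
    using AA unfolding \<A>_def by simp_all
  have "geodesic Y \<V> (subtopology Y A) id a b"
  proof (rule geodesic_minimal_inclusion[OF H Y assms(4) A])
    fix B assume B: "closedin Y B" "connectedin Y B" "B \<subseteq> A" "a \<in> B" "b \<in> B" "convex_pieces Y \<V> C B"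
    then have "compactin Y B" using closed_compactin[OF A(1)] by blast
    then have "B \<in> \<A>" using B A(3) unfolding \<A>_def by blast
    then show "B = A" using min B(3) by blast
  qed
  moreover have "id ` topspace (subtopology Y A) \<subseteq> C" using A(3) by auto
  \<comment> \<open>The domain is a subspace of \<open>Y\<close>, with points of type
    \<open>'a\<close>; \<open>weakly_convex_inI\<close> accepts domains of any type.\<close>
  ultimately show "\<exists>(X :: 'a topology) e x y.
      geodesic Y \<V> X e x y \<and> e x = a \<and> e y = b \<and> e ` topspace X \<subseteq> C"
    by (intro exI[of _ "subtopology Y A"] exI[of _ id] exI[of _ a] exI[of _ b]) simp
qed

end
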